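(* Suppose the one-period demand $D$ has an exponential distribution with mean $\mu$. Let $r^*$ be an optimal constant order quantity, $r^*\in\operatorname{argmin}_{r\in[0,\mu)} C(\mathrm{C}^r)$, let $U^*$ be an optimal projected inventory level, $U^*\in\operatorname{argmin}_{U\ge 0} C(\mathrm{P}^U)$, and let $U(r)=p(\mu-r)/h$. Then for every lead time $\tau\in\mathbb{N}_0$, $$C(\mathrm{P}^{U^*})\le C(\mathrm{P}^{U(r^* )})\le C(\mathrm{C}^{r^*}).$$ That is, the best projected inventory level policy performs at least as well as the best constant order policy.
   Context: Lost sales inventory system. Periods are $t\in\mathbb{N}_0=\{0,1,2,\dots\}$; $\tau\in\mathbb{N}_0$ is the lead time, $h>0$ the holding cost and $p>0$ the lost sales penalty cost. Demands $D_0,D_1,\dots$ are i.i.d. nonnegative random variables distributed as $D$, with $\mu=\mathbb{E}[D]<\infty$. $q_t\ge 0$ is the order arriving at the start of period $t$; the order $q_{t+\tau}$ is placed in period $t$, before $D_t$ is observed. $I_t$ is the inventory at the start of period $t$ after receiving $q_t$. With $(x)^+=\max(0,x)$, the dynamics are $L_t=(D_t-I_t)^+$ (lost sales), $J_t=(I_t-D_t)^+$ (end-of-period inventory), $I_t=J_{t-1}+q_t$. The state in period $t$ is $\mathbf{x}_t=(I_t,q_{t+1},\dots,q_{t+\tau-1})\in\mathbb{R}_+^\tau$ (for $\tau=0$ it is the inventory $J_{t-1}$ before ordering). A policy $\mathrm{A}=\{\mathrm{A}_t\}_{t\in\mathbb{N}_0}$ sets $q_{t+\tau}=\mathrm{A}_t(\mathbf{x}_t)\ge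 0$. The initial state is $\mathbf{x}_0=\mathbf{0}$, i.e. $I_0=0$ and $q_t=0$ for $t<\tau$ (for $\tau=0$: $J_{-1}=0$). The constant order policy $\mathrm{C}^r$, with $0\le r<\mu$, is $\mathrm{C}^r_t(\mathbf{x}_t)=r$. The projected inventory level (PIL) policy $\mathrm{P}^U$, $U\ge 0$, is $\mathrm{P}^U_t(\mathbf{x}_t)=(U-\mathbb{E}[J_{t+\tau-1}\mid\mathbf{x}_t])^+$. The cost in period $t$ is $c_t=hJ_t+pL_t$, and the cost-rate of a policy $\mathrm{A}$ is $C(\mathrm{A})=\limsup_{T\to\infty}\mathbb{E}\big[\frac{1}{T-\tau+1}\sum_{t=\tau}^T c_t\big]$, with costs incurred under $\mathrm{A}$. *)

theory Defs
  imports "HOL-Probability.Probability"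
begin

text \<open>
  A policy maps a period and a state to an order quantity. For lead time \<open>\<tau> \<ge> 1\<close> the state
  in period \<open>t\<close> is the list \<open>[I\<^sub>t, q\<^sub>t\<^sub>+\<^sub>1, \<dots>, q\<^sub>t\<^sub>+\<^sub>\<tau>\<^sub>-\<^sub>1]\<close>, for \<open>\<tau> = 0\<close> it is the singleton \<open>[J\<^sub>t\<^sub>-\<^sub>1]\<close>.
\<close>

type_synonym policy = "nat \<Rightarrow> real list \<Rightarrow> real"

text \<open>
  The system for lead time \<open>\<tau>\<close> under policy \<open>A\<close> and demand path \<open>d\<close>: \<open>prev_inv \<tau> A d t\<close> is \<open>J\<^sub>t\<^sub>-\<^sub>1\<close>
  (shifted by one period, so that \<open>J\<^sub>-\<^sub>1 = 0\<close> is covered), \<open>order_qty \<tau> A d t\<close> is \<open>q\<^sub>t\<close>, the order arriving at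
  the start of period \<open>t\<close>, and \<open>state \<tau> A d t\<close> is the state in which the order \<open>q\<^sub>t\<^sub>+\<^sub>\<tau>\<close> is placed.
\<close>

function (sequential)
  prev_inv :: "nat \<Rightarrow> policy \<Rightarrow> (nat \<Rightarrow> real) \<Rightarrow> nat \<Rightarrow> real"
  and order_qty :: "nat \<Rightarrow> policy \<Rightarrow> (nat \<Rightarrow> real) \<Rightarrow> nat \<Rightarrow> real"
  and state :: "nat \<Rightarrow> policy \<Rightarrow> (nat \<Rightarrow> real) \<Rightarrow> nat \<Rightarrow> real list"
where
  "prev_inv \<tau> A d 0 = 0"
| "prev_inv \<tau> A d (Suc t) = max 0 (prev_inv \<tau> A d t + order_qty \<tau> A d t - d t)"
| "order_qty \<tau> A d s = (if s < \<tau> then 0 else A (s - \<tau>) (state \<tau> A d (s - \<tau>)))"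
| "state \<tau> A d t =
     (if \<tau> = 0 then [prev_inv \<tau> A d t]
      else (prev_inv \<tau> A d t + order_qty \<tau> A d t) # map (order_qty \<tau> A d) [t+1..<t+\<tau>])"
  by pat_completeness auto
termination
  by (relation "Wellfounded.measure (\<lambda>u. case u of
        Inl (\<tau>, A, d, t) \<Rightarrow> 3 * t
      | Inr (Inl (\<tau>, A, d, t)) \<Rightarrow> 3 * t + 2
      | Inr (Inr (\<tau>, A, d, t)) \<Rightarrow> 3 * (t + \<tau>) + 1)") auto

definition inventory :: "nat \<Rightarrow> policy \<Rightarrow> (nat \<Rightarrow> real) \<Rightarrow> nat \<Rightarrow> real" where
  "inventory \<tau> A d t = prev_inv \<tau> A d t + order_qty \<tau> A d t"

definition end_inventory :: "nat \<Rightarrow> policy \<Rightarrow> (nat \<Rightarrow> real) \<Rightarrow> nat \<Rightarrow> real" where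
  "end_inventory \<tau> A d t = max 0 (inventory \<tau> A d t - d t)"

definition lost_sales :: "nat \<Rightarrow> policy \<Rightarrow> (nat \<Rightarrow> real) \<Rightarrow> nat \<Rightarrow> real" where
  "lost_sales \<tau> A d t = max 0 (d t - inventory \<tau> A d t)"

definition period_cost :: "real \<Rightarrow> real \<Rightarrow> nat \<Rightarrow> policy \<Rightarrow> (nat \<Rightarrow> real) \<Rightarrow> nat \<Rightarrow> real" where
  "period_cost h p \<tau> A d t = h * end_inventory \<tau> A d t + p * lost_sales \<tau> A d t"

text \<open>
  Period costs are nonnegative for \<open>h, p \<ge> 0\<close>, so the expectation is taken in \<open>[0,\<infinity>]\<close>.
\<close>

definition cost_rate ::
  "'a measure \<Rightarrow> (nat \<Rightarrow> 'a \<Rightarrow> real) \<Rightarrow> real \<Rightarrow> real \<Rightarrow> nat \<Rightarrow> policy \<Rightarrow> ennreal" where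
  "cost_rate M D h p \<tau> A =
     limsup (\<lambda>T. \<integral>\<^sup>+\<omega>. ennreal (1 / (real T - real \<tau> + 1) *
       (\<Sum>t=\<tau>..T. period_cost h p \<tau> A (\<lambda>s. D s \<omega>) t)) \<partial>M)"

definition constant_order :: "real \<Rightarrow> policy" where
  "constant_order r t x = r"

text \<open>
  \<open>end_inv_from x d n\<close> is the inventory at the end of the \<open>(n+1)\<close>-st period when starting in state
  \<open>x\<close> (for positive lead time \<open>\<tau> > n\<close>) and facing the demands \<open>d 0, \<dots>, d n\<close>.
\<close>

primrec end_inv_from :: "real list \<Rightarrow> (nat \<Rightarrow> real) \<Rightarrow> nat \<Rightarrow> real" where
  "end_inv_from x d 0 = max 0 (x ! 0 - d 0)"
| "end_inv_from x d (Suc n) = max 0 (end_inv_from x d n + x ! Suc n - d (Suc n))"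

text \<open>
  A policy is a function on all states, so \<open>E[J\<^sub>t\<^sub>+\<^sub>\<tau>\<^sub>-\<^sub>1 | x\<^sub>t = x]\<close> is given here by its regular version:
  the expectation over \<open>D\<^sub>t, \<dots>, D\<^sub>t\<^sub>+\<^sub>\<tau>\<^sub>-\<^sub>1\<close> (which are independent of \<open>x\<^sub>t\<close>) of \<open>J\<^sub>t\<^sub>+\<^sub>\<tau>\<^sub>-\<^sub>1\<close> when starting
  from state \<open>x\<close> in period \<open>t\<close>. Lemma \<open>pil_cond_exp\<close> below relates it to the conditional expectation
  given the random state.
\<close>

definition projected_inv ::
  "'a measure \<Rightarrow> (nat \<Rightarrow> 'a \<Rightarrow> real) \<Rightarrow> nat \<Rightarrow> nat \<Rightarrow> real list \<Rightarrow> real" where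
  "projected_inv M D \<tau> t x =
     (if \<tau> = 0 then x ! 0
      else (\<integral>\<omega>. end_inv_from x (\<lambda>i. D (t + i) \<omega>) (\<tau> - 1) \<partial>M))"

definition pil :: "'a measure \<Rightarrow> (nat \<Rightarrow> 'a \<Rightarrow> real) \<Rightarrow> nat \<Rightarrow> real \<Rightarrow> policy" where
  "pil M D \<tau> U t x = max 0 (U - projected_inv M D \<tau> t x)"

definition state_algebra ::
  "'a measure \<Rightarrow> (nat \<Rightarrow> 'a \<Rightarrow> real) \<Rightarrow> nat \<Rightarrow> policy \<Rightarrow> nat \<Rightarrow> 'a measure" where
  "state_algebra M D \<tau> A t =
     vimage_algebra (space M)
       (\<lambda>\<omega>. \<lambda>i\<in>{..<max 1 \<tau>}. state \<tau> A (\<lambda>s. D s \<omega>) t ! i)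
       (\<Pi>\<^sub>M i\<in>{..<max 1 \<tau>}. borel)"

declare prev_inv.simps [simp del] order_qty.simps [simp del] state.simps [simp del]

lemma length_state: "length (state \<tau> A d t) = max 1 \<tau>"
  by (simp add: state.simps)

lemma state_nth:
  "i < max 1 \<tau> \<Longrightarrow> state \<tau> A d t ! i =
    (if \<tau> = 0 then prev_inv \<tau> A d t
     else if i = 0 then prev_inv \<tau> A d t + order_qty \<tau> A d t else order_qty \<tau> A d (t + i))"
  by (auto simp: state.simps nth_Cons')

lemma state_eq_map: "state \<tau> A d t = map (\<lambda>i. state \<tau> A d t ! i) [0..<max 1 \<tau>]"
  by (metis length_state map_nth)

lemma prev_inv_Suc_eq_end_inventory: "prev_inv \<tau> A d (Suc t) = end_inventory \<tau> A d t"
  by (simp add: prev_inv.simps end_inventory_def inventory_def)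

lemma prev_inv_nonneg: "0 \<le> prev_inv \<tau> A d t"
  by (cases t) (auto simp: prev_inv.simps)

lemma end_inv_from_nonneg: "0 \<le> end_inv_from x d n"
  by (cases n) auto

lemma prev_inv_eq_end_inv_from:
  "n < \<tau> \<Longrightarrow> prev_inv \<tau> A d (t + Suc n) = end_inv_from (state \<tau> A d t) (\<lambda>i. d (t + i)) n"
proof (induction n)
  case 0
  then show ?case by (simp add: prev_inv.simps state_nth)
next
  case (Suc n)
  then have "prev_inv \<tau> A d (t + Suc n) = end_inv_from (state \<tau> A d t) (\<lambda>i. d (t + i)) n"
    by simp
  with Suc.prems show ?case
    using prev_inv.simps(2)[of \<tau> A d "t + Suc n"] by (simp add: state_nth)
qed

lemma projected_inv_cong:
  "(\<And>i. i < max 1 \<tau> \<Longrightarrow> x ! i = y ! i) \<Longrightarrow> projected_inv M D \<tau> t x = projected_inv M D \<tau> t y"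
proof -
  assume xy: "\<And>i. i < max 1 \<tau> \<Longrightarrow> x ! i = y ! i"
  have "end_inv_from x d n = end_inv_from y d n" if "n < \<tau>" for d n
    using that by (induction n) (auto simp: xy)
  then show ?thesis
    using xy by (simp add: projected_inv_def)
qed

lemma system_cong:
  shows "(\<And>i. i < t \<Longrightarrow> d i = d' i) \<Longrightarrow> prev_inv \<tau> A d t = prev_inv \<tau> A d' t"
    and "(\<And>i. i < s - \<tau> \<Longrightarrow> d i = d' i) \<Longrightarrow> order_qty \<tau> A d s = order_qty \<tau> A d' s"
    and "(\<And>i. i < t' \<Longrightarrow> d i = d' i) \<Longrightarrow> state \<tau> A d t' = state \<tau> A d' t'"
proof (induction \<tau> A d t and \<tau> A d s and \<tau> A d t' rule: prev_inv_order_qty_state.induct)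
  case (1 \<tau> A d)
  then show ?case by (simp add: prev_inv.simps)
next
  case (2 \<tau> A d t)
  then show ?case by (simp add: prev_inv.simps)
next
  case (3 \<tau> A d s)
  then show ?case by (simp add: order_qty.simps)
next
  case (4 \<tau> A d t)
  then show ?case by (auto simp: state.simps)
qed

definition meas_policy :: "nat \<Rightarrow> policy \<Rightarrow> bool" where
  "meas_policy \<tau> A \<longleftrightarrow>
     (\<forall>t. (\<lambda>v. A t (map v [0..<max 1 \<tau>])) \<in> borel_measurable (\<Pi>\<^sub>M i\<in>{..<max 1 \<tau>}. borel))"

lemma system_measurable:
  fixes d :: "nat \<Rightarrow> 'b \<Rightarrow> real"
  assumes A: "meas_policy \<tau> A" and d [measurable]: "\<And>i. d i \<in> borel_measurable N"
  shows "(\<lambda>\<omega>. prev_inv \<tau> A (\<lambda>i. d i \<omega>) t) \<in> borel_measurable N"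
    and "(\<lambda>\<omega>. order_qty \<tau> A (\<lambda>i. d i \<omega>) s) \<in> borel_measurable N"
    and "i < max 1 \<tau> \<Longrightarrow> (\<lambda>\<omega>. state \<tau> A (\<lambda>i. d i \<omega>) t' ! i) \<in> borel_measurable N"
proof -
  have main: "(t = n \<longrightarrow> (\<lambda>\<omega>. prev_inv \<tau> A (\<lambda>i. d i \<omega>) t) \<in> borel_measurable N) \<and>
      (s = n \<longrightarrow> (\<lambda>\<omega>. order_qty \<tau> A (\<lambda>i. d i \<omega>) s) \<in> borel_measurable N)" for n s t
  proof (induction n arbitrary: s t rule: less_induct)
    case (less n)
    have P: "(\<lambda>\<omega>. prev_inv \<tau> A (\<lambda>i. d i \<omega>) n) \<in> borel_measurable N"
    proof (cases n)
      case 0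
      then show ?thesis by (simp add: prev_inv.simps)
    next
      case (Suc m)
      have [measurable]: "(\<lambda>\<omega>. prev_inv \<tau> A (\<lambda>i. d i \<omega>) m) \<in> borel_measurable N"
        "(\<lambda>\<omega>. order_qty \<tau> A (\<lambda>i. d i \<omega>) m) \<in> borel_measurable N"
        using less[of m] Suc by auto
      show ?thesis unfolding Suc prev_inv.simps by measurable
    qed
    have Q: "(\<lambda>\<omega>. order_qty \<tau> A (\<lambda>i. d i \<omega>) n) \<in> borel_measurable N"
    proof (cases "n < \<tau>")
      case True
      then show ?thesis by (simp add: order_qty.simps)
    next
      case False
      define m where "m = n - \<tau>"
      have X: "(\<lambda>\<omega>. \<lambda>i\<in>{..<max 1 \<tau>}. state \<tau> A (\<lambda>i. d i \<omega>) m ! i)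
          \<in> measurable N (\<Pi>\<^sub>M i\<in>{..<max 1 \<tau>}. borel)"
      proof (rule measurable_restrict)
        fix i assume i: "i \<in> {..<max 1 \<tau>}"
        show "(\<lambda>\<omega>. state \<tau> A (\<lambda>i. d i \<omega>) m ! i) \<in> borel_measurable N"
        proof (cases "\<tau> = 0")
          case True
          then show ?thesis using P i by (simp add: state_nth m_def)
        next
          case tau: False
          then have "m < n" "m + i < n" using False i by (auto simp: m_def)
          then have [measurable]: "(\<lambda>\<omega>. prev_inv \<tau> A (\<lambda>i. d i \<omega>) m) \<in> borel_measurable N"
            "(\<lambda>\<omega>. order_qty \<tau> A (\<lambda>i. d i \<omega>) m) \<in> borel_measurable N"
            "(\<lambda>\<omega>. order_qty \<tau> A (\<lambda>i. d i \<omega>) (m + i)) \<in> borel_measurable N"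
            using less[of m] less[of "m + i"] by auto
          show ?thesis using i tau by (cases "i = 0") (simp_all add: state_nth)
        qed
      qed
      have "(\<lambda>\<omega>. A m (map (\<lambda>i\<in>{..<max 1 \<tau>}. state \<tau> A (\<lambda>i. d i \<omega>) m ! i) [0..<max 1 \<tau>]))
          \<in> borel_measurable N"
        using measurable_compose[OF X] A unfolding meas_policy_def by blast
      moreover have "map (\<lambda>i\<in>{..<max 1 \<tau>}. state \<tau> A (\<lambda>i. d i \<omega>) m ! i) [0..<max 1 \<tau>]
          = state \<tau> A (\<lambda>i. d i \<omega>) m" for \<omega>
        by (subst (2) state_eq_map) (simp del: upt_Suc)
      ultimately show ?thesis using False by (simp add: order_qty.simps m_def)
    qed
    show ?case using P Q by simp
  qed
  then show P: "(\<lambda>\<omega>. prev_inv \<tau> A (\<lambda>i. d i \<omega>) t) \<in> borel_measurable N"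
    and Q: "(\<lambda>\<omega>. order_qty \<tau> A (\<lambda>i. d i \<omega>) s) \<in> borel_measurable N" for t s
    by blast+
  show "i < max 1 \<tau> \<Longrightarrow> (\<lambda>\<omega>. state \<tau> A (\<lambda>i. d i \<omega>) t' ! i) \<in> borel_measurable N"
    using P Q by (cases "\<tau> = 0"; cases "i = 0") (auto simp: state_nth)
qed

lemma end_inv_from_measurable:
  assumes d [measurable]: "\<And>i. i \<le> n \<Longrightarrow> d i \<in> borel_measurable N"
    and x [measurable]: "\<And>i. i \<le> n \<Longrightarrow> (\<lambda>\<omega>. x \<omega> ! i) \<in> borel_measurable N"
  shows "(\<lambda>\<omega>. end_inv_from (x \<omega>) (\<lambda>i. d i \<omega>) n) \<in> borel_measurable N"
  using assms by (induction n) auto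

context prob_space
begin

lemma projected_inv_measurable:
  assumes D [measurable]: "\<And>i. D i \<in> borel_measurable M"
  shows "(\<lambda>v. projected_inv M D \<tau> t (map v [0..<max 1 \<tau>]))
           \<in> borel_measurable (\<Pi>\<^sub>M i\<in>{..<max 1 \<tau>}. borel)"
proof (cases "\<tau> = 0")
  case True
  then show ?thesis by (simp add: projected_inv_def)
next
  case False
  let ?N = "\<Pi>\<^sub>M i\<in>{..<\<tau>}. (borel :: real measure)"
  have "(\<lambda>z. end_inv_from (map (fst z) [0..<\<tau>]) (\<lambda>i. D (t + i) (snd z)) (\<tau> - 1))
      \<in> borel_measurable (?N \<Otimes>\<^sub>M M)"
  proof (rule end_inv_from_measurable)
    fix i assume "i \<le> \<tau> - 1"
    then have i: "i < \<tau>" using False by simp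
    show "(\<lambda>z. D (t + i) (snd z)) \<in> borel_measurable (?N \<Otimes>\<^sub>M M)" by measurable
    have "(\<lambda>z. fst z i) \<in> borel_measurable (?N \<Otimes>\<^sub>M M)"
      by (rule measurable_compose[OF measurable_fst measurable_component_singleton]) (use i in simp)
    then show "(\<lambda>z. map (fst z) [0..<\<tau>] ! i) \<in> borel_measurable (?N \<Otimes>\<^sub>M M)"
      using i by simp
  qed
  then have "(\<lambda>v. \<integral>\<omega>. end_inv_from (map v [0..<\<tau>]) (\<lambda>i. D (t + i) \<omega>) (\<tau> - 1) \<partial>M)
      \<in> borel_measurable ?N"
    by (intro borel_measurable_lebesgue_integral) (simp add: case_prod_beta')
  then show ?thesis using False by (simp add: projected_inv_def max_def del: upt_Suc)
qed

lemma meas_policy_pil: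
  assumes "\<And>i. D i \<in> borel_measurable M"
  shows "meas_policy \<tau> (pil M D \<tau> U)"
  unfolding meas_policy_def pil_def
  by (intro allI borel_measurable_max borel_measurable_diff borel_measurable_const
      projected_inv_measurable[OF assms])

lemma projected_inv_cond_exp:
  assumes indep: "indep_vars (\<lambda>_. borel) D UNIV"
    and A: "meas_policy \<tau> A"
    and int: "integrable M (\<lambda>\<omega>. prev_inv \<tau> A (\<lambda>s. D s \<omega>) (t + \<tau>))"
  shows "AE \<omega> in M.
    real_cond_exp M (state_algebra M D \<tau> A t) (\<lambda>\<omega>. prev_inv \<tau> A (\<lambda>s. D s \<omega>) (t + \<tau>)) \<omega>
      = projected_inv M D \<tau> t (state \<tau> A (\<lambda>s. D s \<omega>) t)"
proof -
  let ?I = "{..<max 1 \<tau>}"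
  let ?S = "\<Pi>\<^sub>M i\<in>?I. (borel :: real measure)"
  define X where "X \<omega> = (\<lambda>i\<in>?I. state \<tau> A (\<lambda>s. D s \<omega>) t ! i)" for \<omega>
  let ?F = "vimage_algebra (space M) X ?S"
  define J where "J \<omega> = prev_inv \<tau> A (\<lambda>s. D s \<omega>) (t + \<tau>)" for \<omega>
  define G where "G v = projected_inv M D \<tau> t (map v [0..<max 1 \<tau>])" for v
  have F: "state_algebra M D \<tau> A t = ?F"
    unfolding state_algebra_def X_def ..
  have D [measurable]: "D i \<in> borel_measurable M" for i
    using indep unfolding indep_vars_def2 by auto
  have X [measurable]: "X \<in> measurable M ?S"
    unfolding X_def by (intro measurable_restrict system_measurable(3)[OF A D]) auto
  have G [measurable]: "G \<in> borel_measurable ?S"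
    unfolding G_def by (rule projected_inv_measurable[OF D])
  have GX: "G (X \<omega>) = projected_inv M D \<tau> t (state \<tau> A (\<lambda>s. D s \<omega>) t)" for \<omega>
    unfolding G_def by (rule projected_inv_cong) (simp add: X_def del: upt_Suc)
  have XF: "X \<in> measurable ?F ?S"
    by (rule measurable_vimage_algebra1) (use X in \<open>auto dest: measurable_space\<close>)
  have setsF: "sets ?F = {X -` B \<inter> space M |B. B \<in> sets ?S}"
    by (rule sets_vimage_algebra2) (use X in \<open>auto dest: measurable_space\<close>)
  have sub: "subalgebra M ?F"
    unfolding subalgebra_def using setsF measurable_sets[OF X] by auto
  interpret finite_measure_subalgebra M ?F
    by unfold_locales (rule sub)

  have main: "integrable M (\<lambda>\<omega>. G (X \<omega>)) \<and>
      (\<forall>B\<in>sets ?S. (\<integral>\<omega>. indicator B (X \<omega>) * J \<omega> \<partial>M) = (\<integral>\<omega>. indicator B (X \<omega>) * G (X \<omega>) \<partial>M))"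
  proof (cases "\<tau> = 0")
    case True
    have "J \<omega> = G (X \<omega>)" for \<omega>
      using True by (simp add: GX projected_inv_def J_def state_nth)
    moreover have "integrable M J" using int unfolding J_def .
    ultimately show ?thesis
      by (metis (no_types, lifting) ext)
  next
    case False
    let ?K = "{t..<t+\<tau>}"
    let ?P = "\<Pi>\<^sub>M i\<in>{..<t}. (borel :: real measure)"
    let ?R = "\<Pi>\<^sub>M i\<in>?K. (borel :: real measure)"
    define Y where "Y \<omega> = (\<lambda>i\<in>?K. D i \<omega>)" for \<omega>
    define \<Psi> where "\<Psi> v = (\<lambda>i\<in>?I. state \<tau> A v t ! i)" for v
    define \<Psi>' where "\<Psi>' v = \<Psi> (\<lambda>i. if i < t then v i else 0)" for v
    define g where "g z = end_inv_from (map (fst z) [0..<max 1 \<tau>]) (\<lambda>i. snd z (t + i)) (\<tau> - 1)"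
      for z :: "(nat \<Rightarrow> real) \<times> (nat \<Rightarrow> real)"
    have Psi: "\<Psi>' \<in> measurable ?P ?S"
      unfolding \<Psi>'_def \<Psi>_def
    proof (intro measurable_restrict system_measurable(3)[OF A])
      fix i :: nat
      show "(\<lambda>v. if i < t then v i else 0) \<in> borel_measurable ?P"
        by (cases "i < t") auto
    qed auto
    have "indep_var ?P (\<lambda>\<omega>. restrict (\<lambda>i. D i \<omega>) {..<t}) ?R (\<lambda>\<omega>. restrict (\<lambda>i. D i \<omega>) ?K)"
      by (rule indep_var_restrict[OF indep]) auto
    from indep_var_compose[OF this Psi measurable_id]
    have "indep_var ?S (\<Psi>' \<circ> (\<lambda>\<omega>. restrict (\<lambda>i. D i \<omega>) {..<t})) ?R Y"
      by (simp add: Y_def[abs_def] comp_def)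
    also have "\<Psi>' \<circ> (\<lambda>\<omega>. restrict (\<lambda>i. D i \<omega>) {..<t}) = X"
    proof
      fix \<omega>
      have "state \<tau> A (\<lambda>i. if i < t then restrict (\<lambda>i. D i \<omega>) {..<t} i else 0) t
          = state \<tau> A (\<lambda>i. D i \<omega>) t"
        by (rule system_cong(3)) simp
      then show "(\<Psi>' \<circ> (\<lambda>\<omega>. restrict (\<lambda>i. D i \<omega>) {..<t})) \<omega> = X \<omega>"
        by (simp add: \<Psi>'_def \<Psi>_def X_def)
    qed
    finally have XY: "indep_var ?S X ?R Y" .
    then have Y [measurable]: "Y \<in> measurable M ?R"
      and dist: "distr M ?S X \<Otimes>\<^sub>M distr M ?R Y = distr M (?S \<Otimes>\<^sub>M ?R) (\<lambda>\<omega>. (X \<omega>, Y \<omega>))"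
      unfolding indep_var_distribution_eq by auto
    have g [measurable]: "g \<in> borel_measurable (?S \<Otimes>\<^sub>M ?R)"
      unfolding g_def
    proof (rule end_inv_from_measurable)
      fix i assume "i \<le> \<tau> - 1"
      then have i: "i < \<tau>" using False by simp
      show "(\<lambda>z. snd z (t + i)) \<in> borel_measurable (?S \<Otimes>\<^sub>M ?R)"
        by (rule measurable_compose[OF measurable_snd measurable_component_singleton]) (use i in simp)
      have "(\<lambda>z. fst z i) \<in> borel_measurable (?S \<Otimes>\<^sub>M ?R)"
        by (rule measurable_compose[OF measurable_fst measurable_component_singleton]) (use i in simp)
      then show "(\<lambda>z. map (fst z) [0..<max 1 \<tau>] ! i) \<in> borel_measurable (?S \<Otimes>\<^sub>M ?R)"
        using i by (simp del: upt_Suc)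
    qed
    have from_cong: "end_inv_from x d n = end_inv_from y e n"
      if "\<And>i. i \<le> n \<Longrightarrow> x ! i = y ! i" "\<And>i. i \<le> n \<Longrightarrow> d i = e i" for x y d e n
      using that by (induction n) auto
    have gG: "(\<integral>\<omega>. g (v, Y \<omega>) \<partial>M) = G v" for v
    proof -
      have "g (v, Y \<omega>) = end_inv_from (map v [0..<max 1 \<tau>]) (\<lambda>i. D (t + i) \<omega>) (\<tau> - 1)" for \<omega>
        unfolding g_def using False by (intro from_cong) (auto simp: Y_def)
      then show ?thesis using False by (simp add: G_def projected_inv_def)
    qed
    have gJ: "g (X \<omega>, Y \<omega>) = J \<omega>" for \<omega>
    proof -
      have "J \<omega> = end_inv_from (state \<tau> A (\<lambda>s. D s \<omega>) t) (\<lambda>i. D (t + i) \<omega>) (\<tau> - 1)"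
        using prev_inv_eq_end_inv_from[of "\<tau> - 1" \<tau> A "\<lambda>s. D s \<omega>" t] False by (simp add: J_def)
      also have "\<dots> = g (X \<omega>, Y \<omega>)"
        unfolding g_def using False
        by (intro from_cong) (auto simp: X_def Y_def simp del: upt_Suc)
      finally show ?thesis ..
    qed
    interpret dX: prob_space "distr M ?S X" by (rule prob_space_distr[OF X])
    interpret dY: prob_space "distr M ?R Y" by (rule prob_space_distr[OF Y])
    interpret XY: pair_prob_space "distr M ?S X" "distr M ?R Y" ..
    have iJ: "integrable M J" using int unfolding J_def .
    have inner: "(\<integral>y. f v * g (v, y) \<partial>distr M ?R Y) = f v * G v" if "v \<in> space ?S"
      for f :: "_ \<Rightarrow> real" and v
    proof -
      have "(\<lambda>y. g (v, y)) \<in> borel_measurable ?R"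
        using that by measurable
      then have "(\<integral>y. g (v, y) \<partial>distr M ?R Y) = G v"
        by (subst integral_distr) (auto simp: gG)
      then show ?thesis by simp
    qed
    have fub: "integrable M (\<lambda>\<omega>. f (X \<omega>) * G (X \<omega>)) \<and>
        (\<integral>\<omega>. f (X \<omega>) * J \<omega> \<partial>M) = (\<integral>\<omega>. f (X \<omega>) * G (X \<omega>) \<partial>M)"
      if f [measurable]: "f \<in> borel_measurable ?S" and "\<And>v. \<bar>f v\<bar> \<le> 1" for f :: "_ \<Rightarrow> real"
    proof -
      let ?fg = "\<lambda>z. f (fst z) * g z"
      have mXY: "(\<lambda>\<omega>. (X \<omega>, Y \<omega>)) \<in> measurable M (?S \<Otimes>\<^sub>M ?R)"
        by (rule measurable_Pair[OF X Y])
      have mfg: "?fg \<in> borel_measurable (?S \<Otimes>\<^sub>M ?R)"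
        by (intro borel_measurable_times g measurable_compose[OF measurable_fst f])
      have mfG: "(\<lambda>v. f v * G v) \<in> borel_measurable ?S"
        by (intro borel_measurable_times f G)
      have ifJ: "integrable M (\<lambda>\<omega>. f (X \<omega>) * J \<omega>)"
        by (rule Bochner_Integration.integrable_bound[OF iJ])
          (use iJ that(2) in \<open>auto simp: abs_mult intro!: mult_left_le_one_le\<close>)
      have int_fg: "integrable (distr M ?S X \<Otimes>\<^sub>M distr M ?R Y) ?fg"
        unfolding dist using ifJ by (simp only: integrable_distr_eq[OF mXY mfg] fst_conv gJ)
      have eq: "(\<integral>y. ?fg (v, y) \<partial>distr M ?R Y) = f v * G v" if "v \<in> space (distr M ?S X)" for v
        using inner[of v f] that by simp
      have "integrable (distr M ?S X) (\<lambda>v. \<integral>y. ?fg (v, y) \<partial>distr M ?R Y)"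
        by (rule XY.integrable_fst'[OF int_fg])
      then have "integrable (distr M ?S X) (\<lambda>v. f v * G v)"
        by (subst (asm) Bochner_Integration.integrable_cong[OF refl eq]) auto
      then have 1: "integrable M (\<lambda>\<omega>. f (X \<omega>) * G (X \<omega>))"
        by (simp only: integrable_distr_eq[OF X mfG])
      have "(\<integral>\<omega>. f (X \<omega>) * J \<omega> \<partial>M) = integral\<^sup>L (distr M ?S X \<Otimes>\<^sub>M distr M ?R Y) ?fg"
        unfolding dist by (simp only: integral_distr[OF mXY mfg] fst_conv gJ)
      also have "\<dots> = (\<integral>v. (\<integral>y. ?fg (v, y) \<partial>distr M ?R Y) \<partial>distr M ?S X)"
        by (rule XY.integral_fst'[OF int_fg, symmetric])
      also have "\<dots> = (\<integral>v. f v * G v \<partial>distr M ?S X)"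
        by (rule Bochner_Integration.integral_cong[OF refl eq])
      also have "\<dots> = (\<integral>\<omega>. f (X \<omega>) * G (X \<omega>) \<partial>M)"
        by (simp only: integral_distr[OF X mfG])
      finally show ?thesis using 1 by simp
    qed
    show ?thesis
      using fub[of "\<lambda>_. 1"] by (auto intro!: fub[THEN conjunct2] simp: indicator_def)
  qed

  have "AE \<omega> in M. real_cond_exp M ?F J \<omega> = G (X \<omega>)"
  proof (rule real_cond_exp_charact)
    fix E assume "E \<in> sets ?F"
    then obtain B where B: "B \<in> sets ?S" "E = X -` B \<inter> space M"
      unfolding setsF by auto
    have *: "(\<integral>\<omega>\<in>E. f \<omega> \<partial>M) = (\<integral>\<omega>. indicator B (X \<omega>) * f \<omega> \<partial>M)" for f :: "'a \<Rightarrow> real"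
      unfolding set_lebesgue_integral_def
      by (rule Bochner_Integration.integral_cong) (auto simp: B indicator_def)
    show "(\<integral>\<omega>\<in>E. J \<omega> \<partial>M) = (\<integral>\<omega>\<in>E. G (X \<omega>) \<partial>M)"
      unfolding * using main B by blast
  next
    show "integrable M J" using int unfolding J_def .
    show "integrable M (\<lambda>\<omega>. G (X \<omega>))" using main by blast
    show "(\<lambda>\<omega>. G (X \<omega>)) \<in> borel_measurable ?F"
      by (rule measurable_compose[OF XF G])
  qed
  then show ?thesis unfolding F GX J_def .
qed

lemma pil_cond_exp:
  fixes \<tau> t :: nat and U :: real
  assumes indep: "indep_vars (\<lambda>_. borel) D UNIV"
    and D: "\<And>i. integrable M (D i)" and U: "U \<ge> 0"
  defines "A \<equiv> pil M D \<tau> U"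
  shows "AE \<omega> in M. A t (state \<tau> A (\<lambda>s. D s \<omega>) t) =
    max 0 (U - real_cond_exp M (state_algebra M D \<tau> A t)
                 (\<lambda>\<omega>. prev_inv \<tau> A (\<lambda>s. D s \<omega>) (t + \<tau>)) \<omega>)"
proof -
  have mA: "meas_policy \<tau> A"
    unfolding A_def using D by (intro meas_policy_pil borel_measurable_integrable)
  have Dm: "D i \<in> borel_measurable M" for i
    using D by (rule borel_measurable_integrable)
  have order: "0 \<le> order_qty \<tau> A d s \<and> order_qty \<tau> A d s \<le> U" for d s
  proof -
    have "0 \<le> projected_inv M D \<tau> k (state \<tau> A d k)" for k
      by (cases "\<tau> = 0")
        (auto simp: projected_inv_def state_nth prev_inv_nonneg end_inv_from_nonneg
           intro!: Bochner_Integration.integral_nonneg)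
    then show ?thesis using U by (auto simp: order_qty.simps A_def pil_def)
  qed
  have io: "integrable M (\<lambda>\<omega>. order_qty \<tau> A (\<lambda>s. D s \<omega>) s)" for s
    by (rule integrable_const_bound[where B = U])
      (use order system_measurable(2)[OF mA Dm] in auto)
  have ip: "integrable M (\<lambda>\<omega>. prev_inv \<tau> A (\<lambda>s. D s \<omega>) k)" for k
    by (induction k) (auto simp: prev_inv.simps io D)
  show ?thesis
    using projected_inv_cond_exp[OF indep mA ip[of "t + \<tau>"]]
    by eventually_elim (simp add: A_def pil_def)
qed

end

end

theory Submission
  imports Defs "HOL-Real_Asymp.Real_Asymp"
begin

text \<open>
  Integration by parts against the exponential density gives
  \<open>E[J\<^sub>t\<^sup>2] + 2 \<mu> E[J\<^sub>t] = E[I\<^sub>t\<^sup>2]\<close>. With \<open>a = h / (2 (\<mu> - r))\<close> and \<open>b = 2 a \<mu> - h - p\<close> this yields, for every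
  policy with bounded orders, \<open>E[c\<^sub>t + a J\<^sub>t\<^sup>2 + b J\<^sub>t] = E[a I\<^sub>t\<^sup>2 - p I\<^sub>t] + p \<mu>\<close>. Hence the relative value function
  of the constant order policy is quadratic. The conditional expectation of the right-hand side
  given the state in which \<open>q\<^sub>t\<close> is placed is a quadratic in \<open>q\<^sub>t\<close>, minimised over \<open>q\<^sub>t \<ge> 0\<close>
  by bringing the projected inventory level up to \<open>p / (2 a) = p (\<mu> - r) / h\<close>: this projected inventory
  level policy is the one-step improvement of ordering \<open>r\<close>. Telescoping bounds its cost rate by
  \<open>a r\<^sup>2 + p (\<mu> - r)\<close>, and the constant order policy costs at least that much.
\<close>

section \<open>An integral identity for the exponential density\<close>

text \<open>On \<open>{0..y}\<close> the integrand times the density is the derivative of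
  \<open>- ((y - x) ^ Suc n * exp (- x / \<mu>))\<close>, which is 0 at \<open>y\<close> and
  \<open>- (y ^ Suc n)\<close> at 0. The density vanishes below 0, and \<open>0 < n\<close> makes
  both powers of the positive part vanish above \<open>y\<close>.\<close>

lemma exp_demand_power:
  fixes \<mu> y :: real
  assumes \<mu>: "0 < \<mu>" and y: "0 \<le> y" and n: "0 < n"
  shows "(\<integral>\<^sup>+x. ennreal (max 0 (y - x) ^ Suc n + real (Suc n) * \<mu> * max 0 (y - x) ^ n)
            \<partial>density lborel (\<lambda>x. ennreal (exponential_density (1 / \<mu>) x))) = ennreal (y ^ Suc n)"
proof -
  let ?F = "\<lambda>x. - ((y - x) ^ Suc n * exp (- x / \<mu>))"
  let ?f = "\<lambda>x. ((y - x) ^ Suc n + real (Suc n) * \<mu> * (y - x) ^ n) * (exp (- x / \<mu>) / \<mu>)"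
  have "(\<integral>\<^sup>+x. ennreal (max 0 (y - x) ^ Suc n + real (Suc n) * \<mu> * max 0 (y - x) ^ n)
            \<partial>density lborel (\<lambda>x. ennreal (exponential_density (1 / \<mu>) x)))
      = (\<integral>\<^sup>+x. ennreal (?f x) * indicator {0..y} x \<partial>lborel)"
  proof (subst nn_integral_density)
    show "(\<integral>\<^sup>+x. ennreal (exponential_density (1 / \<mu>) x)
          * ennreal (max 0 (y - x) ^ Suc n + real (Suc n) * \<mu> * max 0 (y - x) ^ n) \<partial>lborel)
        = (\<integral>\<^sup>+x. ennreal (?f x) * indicator {0..y} x \<partial>lborel)"
      by (rule nn_integral_cong)
        (use \<mu> n in \<open>auto simp: exponential_density_def indicator_def ennreal_mult'[symmetric] max_def
           zero_power mult_ac simp del: ennreal_plus\<close>)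
  qed auto
  also have "\<dots> = ennreal (?F y - ?F 0)"
  proof (rule nn_integral_FTC_Icc)
    fix x assume x: "x \<in> {0..y}"
    show "(?F has_real_derivative ?f x) (at x)"
      by (rule derivative_eq_intros refl | use \<mu> in \<open>simp add: field_simps\<close>)+
    show "0 \<le> ?f x" using x \<mu> by auto
  qed (use y in auto)
  also have "?F y - ?F 0 = y ^ Suc n" by simp
  finally show ?thesis .
qed

section \<open>The demand process\<close>

locale exp_demand = prob_space M for M :: "'a measure" +
  fixes D :: "nat \<Rightarrow> 'a \<Rightarrow> real" and \<mu> :: real
  assumes mean_pos: "0 < \<mu>"
    and indep: "indep_vars (\<lambda>_. borel) D UNIV"
    and exp_distr: "\<And>t. distributed M lborel (D t) (exponential_density (1 / \<mu>))"
begin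

lemma demand_measurable [measurable]: "D t \<in> borel_measurable M"
  using exp_distr[of t] by (simp add: distributed_def)

lemma demand_mean: "expectation (D t) = \<mu>"
  using exponential_distributed_expectation[OF _ exp_distr] mean_pos by simp

lemma demand_integrable: "integrable M (D t)"
  \<comment> \<open>The integral of a non-integrable function is 0 by convention, whereas this one
    equals \<mu> > 0.\<close>
  using demand_mean[of t] mean_pos not_integrable_integral_eq[of M "D t"] by auto

text \<open>\<open>distributed\<close> pushes forward to \<open>lborel\<close>, independence is
  stated over \<open>borel\<close>; the two have the same sets.\<close>

lemma demand_distr:
  "distr M borel (D t) = density lborel (\<lambda>x. ennreal (exponential_density (1 / \<mu>) x))"
  using exp_distr[of t] distr_cong[OF refl sets_lborel] unfolding distributed_def by metis

lemma demand_nonneg: "AE \<omega> in M. \<forall>t. 0 \<le> D t \<omega>"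
proof (subst AE_all_countable, intro allI)
  fix t
  have "AE x in distr M borel (D t). 0 \<le> x"
    unfolding demand_distr by (subst AE_density) (auto simp: exponential_density_def)
  then show "AE \<omega> in M. 0 \<le> D t \<omega>"
    by (subst (asm) AE_distr_iff) auto
qed

end

section \<open>Moments and expected costs under bounded orders\<close>

text \<open>One pathwise bound \<open>B\<close> on all orders gives \<open>Jprev t\<close> \<le> t B
  almost surely, so every moment below is finite. The constant order policy has
  \<open>B = r\<close>, a projected inventory level policy has \<open>B = U\<close>.\<close>

locale exp_demand_policy = exp_demand +
  fixes \<tau> :: nat and A :: policy and B :: real
  assumes meas: "meas_policy \<tau> A"
    and order_nonneg: "\<And>d s. 0 \<le> order_qty \<tau> A d s"
    and order_le: "\<And>d s. order_qty \<tau> A d s \<le> B"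
begin

abbreviation "Jprev t \<omega> \<equiv> prev_inv \<tau> A (\<lambda>s. D s \<omega>) t"
abbreviation "ordq t \<omega> \<equiv> order_qty \<tau> A (\<lambda>s. D s \<omega>) t"

lemma Jprev_measurable [measurable]: "Jprev t \<in> borel_measurable M"
  by (rule system_measurable(1)[OF meas]) simp

lemma ordq_measurable [measurable]: "ordq t \<in> borel_measurable M"
  by (rule system_measurable(2)[OF meas]) simp

lemma Jprev_le: "AE \<omega> in M. \<forall>t. Jprev t \<omega> \<le> real t * B"
  using demand_nonneg
proof eventually_elim
  case (elim \<omega>)
  have B: "0 \<le> B" using order_nonneg order_le order_trans by blast
  show ?case
  proof
    show "Jprev t \<omega> \<le> real t * B" for t
    proof (induction t)
      case 0
      then show ?case by (simp add: prev_inv.simps)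
    next
      case (Suc t)
      then show ?case
        using elim[rule_format, of t] B order_le[of "\<lambda>s. D s \<omega>" t]
        by (simp add: prev_inv.simps algebra_simps)
    qed
  qed
qed

lemma integrable_poly:
  "integrable M (\<lambda>\<omega>. ordq t \<omega> ^ m * Jprev t \<omega> ^ n)"
proof (rule integrable_const_bound[where B = "B ^ m * (real t * B) ^ n"])
  show "AE \<omega> in M. norm (ordq t \<omega> ^ m * Jprev t \<omega> ^ n) \<le> B ^ m * (real t * B) ^ n"
    using Jprev_le
  proof eventually_elim
    case (elim \<omega>)
    have "ordq t \<omega> ^ m \<le> B ^ m" "Jprev t \<omega> ^ n \<le> (real t * B) ^ n"
      using elim order_nonneg order_le prev_inv_nonneg by (auto intro!: power_mono)
    moreover have "0 \<le> B" using order_nonneg order_le order_trans by blast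
    ultimately show ?case
      using order_nonneg prev_inv_nonneg by (auto simp: abs_mult intro!: mult_mono)
  qed
qed measurable

lemma integrable_Jprev_power: "integrable M (\<lambda>\<omega>. Jprev t \<omega> ^ n)"
  using integrable_poly[of t 0 n] by simp

lemma integrable_Jprev: "integrable M (Jprev t)"
  using integrable_poly[of t 0 1] by simp

lemma integrable_ordq: "integrable M (ordq t)"
  using integrable_poly[of t 1 0] by simp

text \<open>The inventory of period t is a function of the demands before t alone. Padding these by
  zeros (\<open>ext\<close>) gives a full path on which the system can be evaluated, and
  \<open>system_cong\<close> says that the padding is not seen.\<close>

lemma indep_inventory_demand:
  "indep_var borel (\<lambda>\<omega>. Jprev t \<omega> + ordq t \<omega>) borel (D t)"
proof -
  let ?P = "\<Pi>\<^sub>M i\<in>{..<t}. (borel :: real measure)"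
  define ext where "ext v i = (if i < t then v i else 0)" for v :: "nat \<Rightarrow> real" and i
  have ext: "(\<lambda>v. ext v i) \<in> borel_measurable ?P" for i
    unfolding ext_def by (cases "i < t") auto
  have 1: "(\<lambda>v. prev_inv \<tau> A (ext v) t + order_qty \<tau> A (ext v) t) \<in> borel_measurable ?P"
    using system_measurable(1,2)[OF meas ext] by simp
  have 2: "(\<lambda>v. v t) \<in> borel_measurable (\<Pi>\<^sub>M i\<in>{t}. (borel :: real measure))"
    by simp
  have "indep_var ?P (\<lambda>\<omega>. restrict (\<lambda>i. D i \<omega>) {..<t})
      (\<Pi>\<^sub>M i\<in>{t}. borel) (\<lambda>\<omega>. restrict (\<lambda>i. D i \<omega>) {t})"
    by (rule indep_var_restrict[OF indep]) auto
  moreover have "prev_inv \<tau> A (ext (\<lambda>i\<in>{..<t}. D i \<omega>)) t = Jprev t \<omega>"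
    and "order_qty \<tau> A (ext (\<lambda>i\<in>{..<t}. D i \<omega>)) t = ordq t \<omega>" for \<omega>
    by (auto simp: ext_def intro!: system_cong)
  ultimately show ?thesis
    by (auto dest!: indep_var_compose[OF _ 1 2] simp: comp_def)
qed

text \<open>
  This replaces the computation of \<open>E[(I - D)\<^sup>+]\<close> and its powers, all of which contain the term
  \<open>exp (- I / \<mu>)\<close>: in the combination below these terms cancel.
\<close>

lemma inventory_moment:
  assumes n: "0 < n"
  shows "expectation (\<lambda>\<omega>. Jprev (Suc t) \<omega> ^ Suc n)
      + real (Suc n) * \<mu> * expectation (\<lambda>\<omega>. Jprev (Suc t) \<omega> ^ n)
    = expectation (\<lambda>\<omega>. (Jprev t \<omega> + ordq t \<omega>) ^ Suc n)"
proof -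
  define I where "I \<omega> = Jprev t \<omega> + ordq t \<omega>" for \<omega>
  define \<phi> where "\<phi> z = max 0 (fst z - snd z) ^ Suc n + real (Suc n) * \<mu> * max 0 (fst z - snd z) ^ n"
    for z :: "real \<times> real"
  have I [measurable]: "I \<in> borel_measurable M" unfolding I_def by measurable
  have I0: "0 \<le> I \<omega>" for \<omega> unfolding I_def using prev_inv_nonneg order_nonneg by simp
  have \<phi> [measurable]: "\<phi> \<in> borel_measurable (borel \<Otimes>\<^sub>M borel)"
    unfolding \<phi>_def by measurable
  have \<phi>0: "0 \<le> \<phi> z" for z unfolding \<phi>_def using mean_pos by simp
  interpret dD: prob_space "distr M borel (D t)" by (rule prob_space_distr) simp
  have dist: "distr M borel I \<Otimes>\<^sub>M distr M borel (D t) = distr M (borel \<Otimes>\<^sub>M borel) (\<lambda>\<omega>. (I \<omega>, D t \<omega>))"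
    using indep_inventory_demand unfolding indep_var_distribution_eq I_def by auto
  have J: "Jprev (Suc t) \<omega> = max 0 (I \<omega> - D t \<omega>)" for \<omega>
    by (simp add: prev_inv.simps I_def)
  \<comment> \<open>In \<open>ennreal\<close>, Tonelli applies directly: by independence the demand
    is integrated out first, at fixed inventory, where \<open>exp_demand_power\<close> gives the
    value.\<close>
  have "(\<integral>\<^sup>+\<omega>. ennreal (\<phi> (I \<omega>, D t \<omega>)) \<partial>M)
      = (\<integral>\<^sup>+z. ennreal (\<phi> z) \<partial>distr M (borel \<Otimes>\<^sub>M borel) (\<lambda>\<omega>. (I \<omega>, D t \<omega>)))"
    by (subst nn_integral_distr) auto
  also have "\<dots> = (\<integral>\<^sup>+z. ennreal (\<phi> z) \<partial>(distr M borel I \<Otimes>\<^sub>M distr M borel (D t)))"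
    unfolding dist ..
  also have "\<dots> = (\<integral>\<^sup>+y. \<integral>\<^sup>+x. ennreal (\<phi> (y, x)) \<partial>distr M borel (D t) \<partial>distr M borel I)"
    by (subst dD.nn_integral_fst[symmetric]) auto
  also have "\<dots> = (\<integral>\<^sup>+\<omega>. \<integral>\<^sup>+x. ennreal (\<phi> (I \<omega>, x)) \<partial>distr M borel (D t) \<partial>M)"
    by (subst nn_integral_distr) auto
  also have "\<dots> = (\<integral>\<^sup>+\<omega>. ennreal (I \<omega> ^ Suc n) \<partial>M)"
    unfolding demand_distr \<phi>_def fst_conv snd_conv using exp_demand_power[OF mean_pos I0 n] by simp
  finally have *: "(\<integral>\<^sup>+\<omega>. ennreal (\<phi> (I \<omega>, D t \<omega>)) \<partial>M) = (\<integral>\<^sup>+\<omega>. ennreal (I \<omega> ^ Suc n) \<partial>M)" .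
  have "expectation (\<lambda>\<omega>. \<phi> (I \<omega>, D t \<omega>)) = expectation (\<lambda>\<omega>. I \<omega> ^ Suc n)"
    using * I0 \<phi>0 by (subst (1 2) integral_eq_nn_integral) auto
  moreover have "expectation (\<lambda>\<omega>. \<phi> (I \<omega>, D t \<omega>)) = expectation (\<lambda>\<omega>. Jprev (Suc t) \<omega> ^ Suc n)
      + real (Suc n) * \<mu> * expectation (\<lambda>\<omega>. Jprev (Suc t) \<omega> ^ n)"
    unfolding \<phi>_def fst_conv snd_conv J[symmetric]
    using integrable_Jprev_power by (subst Bochner_Integration.integral_add) (auto simp del: power_Suc)
  ultimately show ?thesis unfolding I_def by simp
qed

text \<open>The positive part of x minus the positive part of -x is x, so lost sales equal end
  inventory minus inventory plus demand. The cost becomes linear in the state variables;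
  \<open>Jprev (Suc t)\<close> is the end inventory of period t.\<close>

lemma period_cost_eq:
  "period_cost h p \<tau> A (\<lambda>s. D s \<omega>) t
    = (h + p) * Jprev (Suc t) \<omega> + p * (D t \<omega> - Jprev t \<omega> - ordq t \<omega>)"
  by (auto simp: period_cost_def end_inventory_def lost_sales_def inventory_def prev_inv.simps
      max_def algebra_simps)

lemma integrable_period_cost: "integrable M (\<lambda>\<omega>. period_cost h p \<tau> A (\<lambda>s. D s \<omega>) t)"
  unfolding period_cost_eq
  by (intro Bochner_Integration.integrable_add integrable_mult_right Bochner_Integration.integrable_diff
      integrable_Jprev demand_integrable integrable_ordq)

lemma expected_period_cost:
  "expectation (\<lambda>\<omega>. period_cost h p \<tau> A (\<lambda>s. D s \<omega>) t)
    = (h + p) * expectation (Jprev (Suc t)) + p * (\<mu> - expectation (Jprev t) - expectation (ordq t))"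
  unfolding period_cost_eq
  by (simp add: integrable_Jprev demand_integrable integrable_ordq demand_mean)

text \<open>Costs are nonnegative and integrable, so the \<open>ennreal\<close> integral of each
  average with T \<ge> \<tau> is a real expectation; the limsup ignores the other T.\<close>

lemma cost_rate_eq:
  assumes "0 < h" "0 < p"
  shows "cost_rate M D h p \<tau> A = limsup (\<lambda>T. ennreal (1 / (real T - real \<tau> + 1) *
       (\<Sum>t=\<tau>..T. expectation (\<lambda>\<omega>. period_cost h p \<tau> A (\<lambda>s. D s \<omega>) t))))"
  unfolding cost_rate_def
proof (rule Limsup_eq)
  have "(\<integral>\<^sup>+\<omega>. ennreal (1 / (real T - real \<tau> + 1) *
       (\<Sum>t=\<tau>..T. period_cost h p \<tau> A (\<lambda>s. D s \<omega>) t)) \<partial>M) = ennreal (1 / (real T - real \<tau> + 1) *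
       (\<Sum>t=\<tau>..T. expectation (\<lambda>\<omega>. period_cost h p \<tau> A (\<lambda>s. D s \<omega>) t)))" if T: "T \<ge> \<tau>" for T
  proof -
    have "0 \<le> period_cost h p \<tau> A d t" for d t
      using assms by (simp add: period_cost_def end_inventory_def lost_sales_def)
    then have "(\<integral>\<^sup>+\<omega>. ennreal (1 / (real T - real \<tau> + 1) *
       (\<Sum>t=\<tau>..T. period_cost h p \<tau> A (\<lambda>s. D s \<omega>) t)) \<partial>M) = ennreal (expectation (\<lambda>\<omega>. 1 / (real T - real \<tau> + 1) *
       (\<Sum>t=\<tau>..T. period_cost h p \<tau> A (\<lambda>s. D s \<omega>) t)))"
      using T by (intro nn_integral_eq_integral integrable_mult_right Bochner_Integration.integrable_sum
          integrable_period_cost) (auto intro!: sum_nonneg divide_nonneg_nonneg)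
    then show ?thesis by (simp add: integrable_period_cost)
  qed
  then show "\<forall>\<^sub>F T in sequentially. (\<integral>\<^sup>+\<omega>. ennreal (1 / (real T - real \<tau> + 1) *
       (\<Sum>t=\<tau>..T. period_cost h p \<tau> A (\<lambda>s. D s \<omega>) t)) \<partial>M) = ennreal (1 / (real T - real \<tau> + 1) *
       (\<Sum>t=\<tau>..T. expectation (\<lambda>\<omega>. period_cost h p \<tau> A (\<lambda>s. D s \<omega>) t)))"
    by (auto simp: eventually_sequentially)
qed

end

section \<open>A drift criterion\<close>

text \<open>A Foster-Lyapunov argument: if \<open>m\<close> stayed above the bound from some time
  on, \<open>W\<close> would lose at least 1 per period and finally become negative.\<close>

lemma frequently_bounded_of_drift:
  fixes m W :: "nat \<Rightarrow> real"
  assumes \<delta>: "0 < \<delta>" and W: "\<And>t. 0 \<le> W t"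
    and drift: "\<And>t. \<tau> \<le> t \<Longrightarrow> W (Suc t) \<le> W t - \<delta> * m t + C"
  shows "\<exists>\<^sub>F t in sequentially. m t \<le> (C + 1) / \<delta>"
proof (rule ccontr)
  assume "\<not> ?thesis"
  then have "\<forall>\<^sub>F t in sequentially. (C + 1) / \<delta> < m t"
    by (simp add: not_frequently not_le)
  then obtain N where N: "\<And>t. t \<ge> N \<Longrightarrow> (C + 1) / \<delta> < m t"
    by (auto simp: eventually_sequentially)
  define K where "K = max N \<tau>"
  have "W (K + n) \<le> W K - real n" for n
  proof (induction n)
    case (Suc n)
    have "C + 1 < \<delta> * m (K + n)"
      using N[of "K + n"] \<delta> by (simp add: K_def field_simps)
    moreover have "W (Suc (K + n)) \<le> W (K + n) - \<delta> * m (K + n) + C"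
      by (rule drift) (simp add: K_def)
    ultimately show ?case using Suc by simp
  qed simp
  moreover obtain n where "W K < real n" using reals_Archimedean2 by blast
  ultimately show False using W[of "K + n"] by (smt (verit))
qed

section \<open>Lower bound for the constant order policy\<close>

context exp_demand
begin

text \<open>By telescoping, the average cost over N periods is
  \<open>g + (V \<tau> - V (Suc T)) / N\<close>. A lower bound on a limsup needs \<open>V\<close>
  bounded above only along a subsequence, which a drift argument supplies.\<close>

lemma constant_order_rate_ge:
  assumes h: "0 < h" and p: "0 < p" and r: "0 \<le> r" "r < \<mu>"
  shows "ennreal (h * r\<^sup>2 / (2 * (\<mu> - r)) + p * (\<mu> - r))
    \<le> cost_rate M D h p \<tau> (constant_order r)"
proof -
  interpret P: exp_demand_policy M D \<mu> \<tau> "constant_order r" r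
    by unfold_locales
      (use r in \<open>auto simp: meas_policy_def constant_order_def order_qty.simps\<close>)
  \<comment> \<open>\<open>a x\<^sup>2 + b x\<close> is the relative value function and \<open>g\<close> the cost rate of the constant order policy.\<close>
  define a where "a = h / (2 * (\<mu> - r))"
  define b where "b = 2 * a * \<mu> - h - p"
  define g where "g = a * r\<^sup>2 + p * (\<mu> - r)"
  define m where "m n t = expectation (\<lambda>\<omega>. P.Jprev t \<omega> ^ n)" for n t
  define V where "V t = a * m 2 t + b * m 1 t" for t
  have a: "0 < a" and ah: "2 * a * (\<mu> - r) = h" using h r by (auto simp: a_def field_simps)
  have m_nonneg: "0 \<le> m n t" for n t
    unfolding m_def by (intro Bochner_Integration.integral_nonneg) (simp add: prev_inv_nonneg)
  have q: "P.ordq t \<omega> = r" if "\<tau> \<le> t" for t \<omega>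
    using that by (simp add: order_qty.simps constant_order_def)
  have int: "integrable M (\<lambda>\<omega>. P.Jprev t \<omega> ^ n)" "integrable M (P.Jprev t)" for n t
    using P.integrable_Jprev_power P.integrable_Jprev by auto
  have m2: "m 2 (Suc t) + 2 * \<mu> * m 1 (Suc t) = m 2 t + 2 * r * m 1 t + r\<^sup>2" if t: "\<tau> \<le> t" for t
  proof -
    have "m 2 (Suc t) + 2 * \<mu> * m 1 (Suc t) = expectation (\<lambda>\<omega>. (P.Jprev t \<omega> + r)\<^sup>2)"
      using P.inventory_moment[of 1 t] q[OF t] by (simp add: m_def numeral_2_eq_2)
    also have "\<dots> = expectation (\<lambda>\<omega>. P.Jprev t \<omega> ^ 2 + 2 * r * P.Jprev t \<omega> + r\<^sup>2)"
      by (simp add: power2_eq_square algebra_simps)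
    finally show ?thesis by (simp add: m_def int prob_space)
  qed
  have m3: "m 3 (Suc t) + 3 * \<mu> * m 2 (Suc t) = m 3 t + 3 * r * m 2 t + 3 * r\<^sup>2 * m 1 t + r ^ 3"
    if t: "\<tau> \<le> t" for t
  proof -
    have "m 3 (Suc t) + 3 * \<mu> * m 2 (Suc t) = expectation (\<lambda>\<omega>. (P.Jprev t \<omega> + r) ^ 3)"
      using P.inventory_moment[of 2 t] q[OF t] by (simp add: m_def numeral_3_eq_3 numeral_2_eq_2)
    also have "\<dots> = expectation (\<lambda>\<omega>. P.Jprev t \<omega> ^ 3 + 3 * r * P.Jprev t \<omega> ^ 2 + 3 * r\<^sup>2 * P.Jprev t \<omega> + r ^ 3)"
      by (simp add: power2_eq_square power3_eq_cube algebra_simps)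
    finally show ?thesis by (simp add: m_def int prob_space)
  qed
  have m1_le: "2 * x * m 1 t \<le> m 2 t + x\<^sup>2" for x t
  proof -
    have "0 \<le> expectation (\<lambda>\<omega>. (P.Jprev t \<omega> - x)\<^sup>2)"
      by (intro Bochner_Integration.integral_nonneg) simp
    also have "\<dots> = expectation (\<lambda>\<omega>. P.Jprev t \<omega> ^ 2 - 2 * x * P.Jprev t \<omega> + x\<^sup>2)"
      by (simp add: power2_eq_square algebra_simps)
    finally show ?thesis by (simp add: m_def int prob_space)
  qed
  define c where "c t = expectation (\<lambda>\<omega>. period_cost h p \<tau> (constant_order r) (\<lambda>s. D s \<omega>) t)" for t
  \<comment> \<open>The Poisson equation: \<open>b\<close> is chosen to cancel \<open>h + p\<close>
    in front of \<open>m 1 (Suc t)\<close>, and \<open>2 * a * (\<mu> - r) = h\<close> then matches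
    the coefficients of \<open>m 1 t\<close>.\<close>
  have c: "c t = g + V t - V (Suc t)" if t: "\<tau> \<le> t" for t
  proof -
    have "c t = (h + p) * m 1 (Suc t) + p * (\<mu> - m 1 t - r)"
      unfolding c_def P.expected_period_cost using q[OF t] by (simp add: m_def prob_space)
    moreover have "a * (m 2 (Suc t) + 2 * \<mu> * m 1 (Suc t)) = a * (m 2 t + 2 * r * m 1 t + r\<^sup>2)"
      using m2[OF t] by simp
    moreover have "h * m 1 t = 2 * a * (\<mu> - r) * m 1 t" using ah by simp
    ultimately show ?thesis by (simp add: V_def b_def g_def algebra_simps)
  qed
  have sum_c: "(\<Sum>t=\<tau>..T. c t) = g * (real T - real \<tau> + 1) + V \<tau> - V (Suc T)" if "\<tau> \<le> T" for T
    using that by (induction T rule: dec_induct) (auto simp: c algebra_simps)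
  \<comment> \<open>A cubic Lyapunov function bounds the second moment along a subsequence, which makes the
    boundary term \<open>V (Suc T)\<close> negligible there.\<close>
  define \<delta> where "\<delta> = \<mu> - r"
  have \<delta>: "0 < \<delta>" using r by (simp add: \<delta>_def)
  \<comment> \<open>The recursion \<open>m3\<close> has drift \<open>- 3 * \<delta> * m 2 t\<close>;
    this \<open>x\<close> lets \<open>m1_le\<close> absorb the linear term at the price of one
    \<open>\<delta> * m 2 t\<close>, leaving \<open>- 2 * \<delta> * m 2 t\<close>.\<close>
  define x where "x = 3 * r\<^sup>2 / (2 * \<delta>)"
  have "m 3 (Suc t) + 3 * \<mu> * m 2 (Suc t) \<le> (m 3 t + 3 * \<mu> * m 2 t) - (2 * \<delta>) * m 2 t + (\<delta> * x\<^sup>2 + r ^ 3)"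
    if t: "\<tau> \<le> t" for t
  proof -
    have "3 * r\<^sup>2 * m 1 t = \<delta> * (2 * x * m 1 t)" using \<delta> by (simp add: x_def)
    also have "\<dots> \<le> \<delta> * (m 2 t + x\<^sup>2)" using m1_le \<delta> by (intro mult_left_mono) auto
    finally show ?thesis using m3[OF t] by (simp add: \<delta>_def algebra_simps)
  qed
  then have "\<exists>\<^sub>F t in sequentially. m 2 t \<le> (\<delta> * x\<^sup>2 + r ^ 3 + 1) / (2 * \<delta>)"
    using \<delta> m_nonneg mean_pos
    by (intro frequently_bounded_of_drift[where W = "\<lambda>t. m 3 t + 3 * \<mu> * m 2 t" and \<tau> = \<tau>]) auto
  then obtain K where K: "\<exists>\<^sub>F t in sequentially. m 2 t \<le> K" ..
  have V_le: "V t \<le> (a + \<bar>b\<bar>) * K + \<bar>b\<bar>" if "m 2 t \<le> K" for t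
  proof -
    have "m 1 t \<le> K + 1" using m1_le[of 1 t] m_nonneg[of 1 t] that by simp
    then have "b * m 1 t \<le> \<bar>b\<bar> * (K + 1)"
      using m_nonneg[of 1 t] by (intro mult_mono) auto
    moreover have "a * m 2 t \<le> a * K" using that a by simp
    ultimately show ?thesis by (simp add: V_def algebra_simps)
  qed
  define K' where "K' = V \<tau> - ((a + \<bar>b\<bar>) * K + \<bar>b\<bar>)"
  define S where "S T = 1 / (real T - real \<tau> + 1) * (\<Sum>t=\<tau>..T. c t)" for T
  have S_ge: "g + K' / (real T - real \<tau> + 1) \<le> S T" if T: "\<tau> \<le> T" "m 2 (Suc T) \<le> K" for T
  proof -
    have N: "0 < real T - real \<tau> + 1" using T(1) by simp
    have "g + K' / (real T - real \<tau> + 1) = (g * (real T - real \<tau> + 1) + K') / (real T - real \<tau> + 1)"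
      using N by (simp add: add_divide_distrib)
    also have "\<dots> \<le> (\<Sum>t=\<tau>..T. c t) / (real T - real \<tau> + 1)"
      using sum_c[OF T(1)] V_le[OF T(2)] N by (intro divide_right_mono) (auto simp: K'_def)
    finally show ?thesis by (simp add: S_def)
  qed
  have lim: "(\<lambda>T. g + K' / (real T - real \<tau> + 1)) \<longlonglongrightarrow> g"
    by real_asymp
  have "infinite {T. \<tau> \<le> T \<and> m 2 (Suc T) \<le> K}"
  proof -
    have "frequently (\<lambda>t. m 2 (Suc t) \<le> K) sequentially"
      using K eventually_sequentially_Suc[of "\<lambda>t. \<not> m 2 t \<le> K"] by (simp add: frequently_def)
    from frequently_eventually_frequently[OF this eventually_ge_at_top[of \<tau>]]
    have "\<exists>\<^sub>F t in sequentially. \<tau> \<le> t \<and> m 2 (Suc t) \<le> K"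
      by (rule frequently_elim1) simp
    then show ?thesis by (simp add: frequently_cofinite[symmetric] cofinite_eq_sequentially)
  qed
  then obtain s :: "nat \<Rightarrow> nat" where s: "strict_mono s" "\<And>n. \<tau> \<le> s n \<and> m 2 (Suc (s n)) \<le> K"
    using infinite_enumerate by blast
  have "ennreal g = limsup (\<lambda>n. ennreal (g + K' / (real (s n) - real \<tau> + 1)))"
    using LIMSEQ_subseq_LIMSEQ[OF lim s(1)]
    by (intro lim_imp_Limsup[symmetric] tendsto_ennrealI) (auto simp: comp_def)
  also have "\<dots> \<le> limsup (\<lambda>n. ennreal (S (s n)))"
    using S_ge s(2) by (intro Limsup_mono always_eventually allI ennreal_leI) auto
  also have "\<dots> \<le> limsup (\<lambda>T. ennreal (S T))"
    using limsup_subseq_mono[OF s(1), of "\<lambda>T. ennreal (S T)"] by (simp add: comp_def)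
  also have "\<dots> = cost_rate M D h p \<tau> (constant_order r)"
    unfolding P.cost_rate_eq[OF h p] S_def c_def ..
  finally show ?thesis by (simp add: g_def a_def)
qed

section \<open>Upper bound for the projected inventory level policy\<close>

text \<open>Yields the bound \<open>U\<close> on the orders. It concerns reachable states: for
  \<tau> = 0 an arbitrary list may have a negative entry.\<close>

lemma projected_inv_state_nonneg: "0 \<le> projected_inv M D \<tau> t (state \<tau> A d t)"
  by (cases "\<tau> = 0")
    (auto simp: projected_inv_def state_nth prev_inv_nonneg end_inv_from_nonneg
       intro!: Bochner_Integration.integral_nonneg)

lemma subalgebra_state_algebra:
  assumes "meas_policy \<tau> A"
  shows "subalgebra M (state_algebra M D \<tau> A t)"
proof -
  let ?I = "{..<max 1 \<tau>}"
  define X where "X \<omega> = (\<lambda>i\<in>?I. state \<tau> A (\<lambda>s. D s \<omega>) t ! i)" for \<omega>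
  have X: "X \<in> measurable M (\<Pi>\<^sub>M i\<in>?I. (borel :: real measure))"
    unfolding X_def by (intro measurable_restrict system_measurable(3)[OF assms]) auto
  show ?thesis
    unfolding subalgebra_def state_algebra_def X_def[symmetric]
    using sets_vimage_algebra2[of X "space M"] measurable_space[OF X] measurable_sets[OF X] by fastforce
qed

text \<open>Here a lower bound on \<open>V\<close> suffices, and completing the square gives one
  uniform in t because \<open>a\<close> is positive.\<close>

lemma pil_rate_le:
  assumes h: "0 < h" and p: "0 < p" and r: "0 \<le> r" "r < \<mu>"
  shows "cost_rate M D h p \<tau> (pil M D \<tau> (p * (\<mu> - r) / h))
    \<le> ennreal (h * r\<^sup>2 / (2 * (\<mu> - r)) + p * (\<mu> - r))"
proof -
  define U where "U = p * (\<mu> - r) / h"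
  have U: "0 \<le> U" using h p r by (simp add: U_def)
  interpret P: exp_demand_policy M D \<mu> \<tau> "pil M D \<tau> U" U
    by unfold_locales
      (use U projected_inv_state_nonneg in \<open>auto simp: order_qty.simps pil_def intro!: meas_policy_pil\<close>)
  define a where "a = h / (2 * (\<mu> - r))"
  define b where "b = 2 * a * \<mu> - h - p"
  define g where "g = a * r\<^sup>2 + p * (\<mu> - r)"
  define m where "m n t = expectation (\<lambda>\<omega>. P.Jprev t \<omega> ^ n)" for n t
  define V where "V t = a * m 2 t + b * m 1 t" for t
  \<comment> \<open>\<open>p = 2 * a * U\<close> places the vertex of
    \<open>a * y\<^sup>2 - p * y\<close> at \<open>U\<close>, which is why this level is the
    improving one.\<close>
  have a: "0 < a" and ah: "2 * a * (\<mu> - r) = h" and aU: "p = 2 * a * U"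
    using h r by (auto simp: a_def U_def field_simps)
  have int: "integrable M (\<lambda>\<omega>. P.Jprev t \<omega> ^ n)" "integrable M (P.Jprev t)" "integrable M (P.ordq t)" for n t
    using P.integrable_Jprev_power P.integrable_Jprev P.integrable_ordq by auto
  have int': "integrable M (\<lambda>\<omega>. P.ordq t \<omega> * P.Jprev t \<omega>)" "integrable M (\<lambda>\<omega>. (P.ordq t \<omega>)\<^sup>2)" for t
    using P.integrable_poly[of t 1 1] P.integrable_poly[of t 2 0] by auto
  \<comment> \<open>The order enters the one-step cost plus relative value only through \<open>a (J + q)\<^sup>2 - p (J + q)\<close>,
    whose conditional expectation is minimal over \<open>q \<ge> 0\<close> at the projected inventory level order.\<close>
  have improve: "expectation (\<lambda>\<omega>. (P.ordq t \<omega> - r) * (a * (2 * P.Jprev t \<omega> + P.ordq t \<omega> + r) - p)) \<le> 0"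
    if t: "\<tau> \<le> t" for t
  proof -
    \<comment> \<open>The order arriving in t was placed in t - \<tau>, so that state is conditioned
      on. \<open>q\<close> below is an \<open>F\<close>-measurable version of the order, which
      allows \<open>Jprev t\<close> to be replaced by \<open>G\<close> in the product.\<close>
    define F where "F = state_algebra M D \<tau> (pil M D \<tau> U) (t - \<tau>)"
    define G where "G = real_cond_exp M F (P.Jprev t)"
    define q where "q \<omega> = max 0 (U - G \<omega>)" for \<omega>
    interpret F: finite_measure_subalgebra M F
      by unfold_locales (simp add: F_def subalgebra_state_algebra P.meas)
    have q_eq: "AE \<omega> in M. P.ordq t \<omega> = q \<omega>"
      using pil_cond_exp[OF indep demand_integrable U, of \<tau> "t - \<tau>"] t
      unfolding q_def G_def F_def by (simp add: order_qty.simps not_less)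
    have G_meas: "G \<in> borel_measurable F" unfolding G_def by simp
    then have q_meas: "q \<in> borel_measurable F" unfolding q_def by simp
    have qM [measurable]: "q \<in> borel_measurable M" and GM [measurable]: "G \<in> borel_measurable M"
      using measurable_from_subalg[OF F.subalg] q_meas G_meas by auto
    have i1: "integrable M (\<lambda>\<omega>. (P.ordq t \<omega> - r) * P.Jprev t \<omega>)"
      using int int' by (simp add: left_diff_distrib)
    have i2: "integrable M (\<lambda>\<omega>. (q \<omega> - r) * P.Jprev t \<omega>)"
      using i1 by (rule integrable_cong_AE_imp) (use q_eq in \<open>auto elim: eventually_mono\<close>)
    note cond = F.real_cond_exp_intg[OF i2, folded G_def]
    have i3: "integrable M (\<lambda>\<omega>. (P.ordq t \<omega> - r) * (P.ordq t \<omega> + r))"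
      using int int' by (simp add: algebra_simps power2_eq_square)
    have i4: "integrable M (\<lambda>\<omega>. (q \<omega> - r) * (q \<omega> + r))"
      using i3 by (rule integrable_cong_AE_imp) (use q_eq in \<open>auto elim: eventually_mono\<close>)
    have i5: "integrable M (\<lambda>\<omega>. q \<omega> - r)"
      using int(3)[of t] by (intro Bochner_Integration.integrable_diff)
        (auto intro: integrable_cong_AE_imp simp: q_eq elim: eventually_mono)
    have "expectation (\<lambda>\<omega>. (P.ordq t \<omega> - r) * (a * (2 * P.Jprev t \<omega> + P.ordq t \<omega> + r) - p))
        = expectation (\<lambda>\<omega>. (q \<omega> - r) * (a * (2 * P.Jprev t \<omega> + q \<omega> + r) - p))"
      by (rule integral_cong_AE) (use q_eq in \<open>auto elim: eventually_mono\<close>)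
    also have "\<dots> = expectation (\<lambda>\<omega>. 2 * a * ((q \<omega> - r) * P.Jprev t \<omega>)
        + a * ((q \<omega> - r) * (q \<omega> + r)) - p * (q \<omega> - r))"
      by (simp add: algebra_simps)
    also have "\<dots> = expectation (\<lambda>\<omega>. 2 * a * ((q \<omega> - r) * G \<omega>)
        + a * ((q \<omega> - r) * (q \<omega> + r)) - p * (q \<omega> - r))"
      using i2 i4 i5 cond q_meas by simp
    also have "\<dots> \<le> 0"
    proof -
      have "2 * a * ((q \<omega> - r) * G \<omega>) + a * ((q \<omega> - r) * (q \<omega> + r)) - p * (q \<omega> - r) \<le> 0" for \<omega>
      proof -
        have "2 * a * ((q \<omega> - r) * G \<omega>) + a * ((q \<omega> - r) * (q \<omega> + r)) - p * (q \<omega> - r)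
            = a * ((q \<omega> - r) * (2 * (G \<omega> - U) + q \<omega> + r))"
          unfolding aU by (simp add: algebra_simps)
        moreover have "(q \<omega> - r) * (2 * (G \<omega> - U) + q \<omega> + r) \<le> 0"
        \<comment> \<open>If \<open>G\<close> \<le> \<open>U\<close>, the order is the unconstrained
          minimiser and the gap to \<open>r\<close> is a perfect square. Otherwise the order is 0
          and the two factors have opposite signs or vanish.\<close>
        proof (cases "G \<omega> \<le> U")
          case True
          then have "(q \<omega> - r) * (2 * (G \<omega> - U) + q \<omega> + r) = - (q \<omega> - r)\<^sup>2"
            by (simp add: q_def power2_eq_square algebra_simps)
          then show ?thesis by simp
        next
          case False
          then show ?thesis using r by (simp add: q_def mult_le_0_iff)
        qed
        ultimately show ?thesis using a by (simp add: mult_le_0_iff)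
      qed
      then have "0 \<le> expectation (\<lambda>\<omega>. - (2 * a * ((q \<omega> - r) * G \<omega>)
          + a * ((q \<omega> - r) * (q \<omega> + r)) - p * (q \<omega> - r)))"
        by (intro Bochner_Integration.integral_nonneg) simp
      then show ?thesis
        by (simp only: Bochner_Integration.integral_minus neg_0_le_iff_le)
    qed
    finally show ?thesis .
  qed
  define c where "c t = expectation (\<lambda>\<omega>. period_cost h p \<tau> (pil M D \<tau> U) (\<lambda>s. D s \<omega>) t)" for t
  \<comment> \<open>Facts \<open>1\<close> and \<open>2\<close> are the exact balance for the actual
    order. Fact \<open>3\<close> says that ordering \<open>r\<close> instead cannot lower the
    expected quadratic, so the Poisson equation survives as an inequality.\<close>
  have c: "c t \<le> g + V t - V (Suc t)" if t: "\<tau> \<le> t" for t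
  proof -
    have 1: "c t = (h + p) * m 1 (Suc t) + p * (\<mu> - m 1 t - expectation (P.ordq t))"
      unfolding c_def P.expected_period_cost by (simp add: m_def)
    have "m 2 (Suc t) + 2 * \<mu> * m 1 (Suc t) = expectation (\<lambda>\<omega>. (P.Jprev t \<omega> + P.ordq t \<omega>)\<^sup>2)"
      using P.inventory_moment[of 1 t] by (simp add: m_def numeral_2_eq_2)
    also have "\<dots> = expectation (\<lambda>\<omega>. P.Jprev t \<omega> ^ 2 + 2 * (P.ordq t \<omega> * P.Jprev t \<omega>) + (P.ordq t \<omega>)\<^sup>2)"
      by (simp add: power2_eq_square algebra_simps)
    also have "\<dots> = m 2 t + 2 * expectation (\<lambda>\<omega>. P.ordq t \<omega> * P.Jprev t \<omega>) + expectation (\<lambda>\<omega>. (P.ordq t \<omega>)\<^sup>2)"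
      by (simp add: m_def int int')
    finally have 2: "a * (m 2 (Suc t) + 2 * \<mu> * m 1 (Suc t))
      = a * (m 2 t + 2 * expectation (\<lambda>\<omega>. P.ordq t \<omega> * P.Jprev t \<omega>) + expectation (\<lambda>\<omega>. (P.ordq t \<omega>)\<^sup>2))"
      by simp
    have "expectation (\<lambda>\<omega>. (P.ordq t \<omega> - r) * (a * (2 * P.Jprev t \<omega> + P.ordq t \<omega> + r) - p))
      = expectation (\<lambda>\<omega>. 2 * a * (P.ordq t \<omega> * P.Jprev t \<omega>) + a * (P.ordq t \<omega>)\<^sup>2 - p * P.ordq t \<omega>
          - 2 * a * r * P.Jprev t \<omega> - (a * r\<^sup>2 - p * r))"
      by (simp add: power2_eq_square algebra_simps)
    then have 3: "2 * a * expectation (\<lambda>\<omega>. P.ordq t \<omega> * P.Jprev t \<omega>) + a * expectation (\<lambda>\<omega>. (P.ordq t \<omega>)\<^sup>2)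
        - p * expectation (P.ordq t) - 2 * a * r * m 1 t - (a * r\<^sup>2 - p * r) \<le> 0"
      using improve[OF t] by (simp add: m_def int int' prob_space)
    have "h * m 1 t = 2 * a * (\<mu> - r) * m 1 t" using ah by simp
    with 1 2 3 show ?thesis by (simp add: V_def b_def g_def algebra_simps)
  qed
  have sum_c: "(\<Sum>t=\<tau>..T. c t) \<le> g * (real T - real \<tau> + 1) + V \<tau> - V (Suc T)" if "\<tau> \<le> T" for T
    using that
  proof (induction T rule: dec_induct)
    case base
    then show ?case using c[of \<tau>] by simp
  next
    case (step T)
    then show ?case using c[of "Suc T"] by (simp add: algebra_simps)
  qed
  have V_ge: "- (b\<^sup>2 / (4 * a)) \<le> V t" for t
  proof -
    have "0 \<le> expectation (\<lambda>\<omega>. a * (P.Jprev t \<omega> + b / (2 * a))\<^sup>2)"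
      using a by (intro Bochner_Integration.integral_nonneg) simp
    also have "\<dots> = expectation (\<lambda>\<omega>. a * P.Jprev t \<omega> ^ 2 + b * P.Jprev t \<omega> + b\<^sup>2 / (4 * a))"
      using a by (intro Bochner_Integration.integral_cong) (auto simp: power2_eq_square field_simps)
    finally show ?thesis by (simp add: V_def m_def int prob_space)
  qed
  define K where "K = V \<tau> + b\<^sup>2 / (4 * a)"
  have "1 / (real T - real \<tau> + 1) * (\<Sum>t=\<tau>..T. c t) \<le> g + K / (real T - real \<tau> + 1)" if T: "\<tau> \<le> T" for T
  proof -
    have N: "0 < real T - real \<tau> + 1" using T by simp
    have "(\<Sum>t=\<tau>..T. c t) / (real T - real \<tau> + 1)
        \<le> (g * (real T - real \<tau> + 1) + K) / (real T - real \<tau> + 1)"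
      using sum_c[OF T] V_ge[of "Suc T"] N by (intro divide_right_mono) (auto simp: K_def)
    then show ?thesis using N by (simp add: add_divide_distrib)
  qed
  then have "cost_rate M D h p \<tau> (pil M D \<tau> U) \<le> limsup (\<lambda>T. ennreal (g + K / (real T - real \<tau> + 1)))"
    unfolding P.cost_rate_eq[OF h p] c_def[symmetric]
    by (intro Limsup_mono eventually_mono[OF eventually_ge_at_top[of \<tau>]] ennreal_leI)
  also have "\<dots> = ennreal g"
    by (intro lim_imp_Limsup tendsto_ennrealI) (simp, real_asymp)
  finally show ?thesis by (simp add: U_def g_def a_def)
qed

end

section \<open>Comparison of the optimal policies\<close>

theorem theorem1:
  fixes M :: "'a measure" and D :: "nat \<Rightarrow> 'a \<Rightarrow> real"
    and \<mu> h p r U :: real and \<tau> :: nat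
  assumes "prob_space M"
    and "0 < \<mu>" and "0 < h" and "0 < p"
    and "prob_space.indep_vars M (\<lambda>_. borel) D UNIV"
    and "\<And>t. distributed M lborel (D t) (exponential_density (1 / \<mu>))"
    and "is_arg_min (\<lambda>r. cost_rate M D h p \<tau> (constant_order r)) (\<lambda>r. r \<in> {0..<\<mu>}) r"
    and "is_arg_min (\<lambda>U. cost_rate M D h p \<tau> (pil M D \<tau> U)) (\<lambda>U. 0 \<le> U) U"
  shows "cost_rate M D h p \<tau> (pil M D \<tau> U)
           \<le> cost_rate M D h p \<tau> (pil M D \<tau> (p * (\<mu> - r) / h))
       \<and> cost_rate M D h p \<tau> (pil M D \<tau> (p * (\<mu> - r) / h))
           \<le> cost_rate M D h p \<tau> (constant_order r)"
proof
  interpret prob_space M by fact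
  interpret exp_demand M D \<mu>
    by unfold_locales (use assms in auto)
  have r: "0 \<le> r" "r < \<mu>" using assms(7) by (auto simp: is_arg_min_def)
  \<comment> \<open>The upper and the lower bound meet at the same constant
    \<open>h * r\<^sup>2 / (2 * (\<mu> - r)) + p * (\<mu> - r)\<close>.\<close>
  then show "cost_rate M D h p \<tau> (pil M D \<tau> (p * (\<mu> - r) / h)) \<le> cost_rate M D h p \<tau> (constant_order r)"
    using order_trans[OF pil_rate_le constant_order_rate_ge] assms(3,4) by simp
  have "0 \<le> p * (\<mu> - r) / h" using r assms(3,4) by simp
  then show "cost_rate M D h p \<tau> (pil M D \<tau> U) \<le> cost_rate M D h p \<tau> (pil M D \<tau> (p * (\<mu> - r) / h))"
    using assms(8) by (auto simp: is_arg_min_def not_less)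
qed

end
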